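(* Let $\nu\in(0,1)$, $h,\lambda>0$ and $c>0$. Let $\{T_n^{(\nu)}:n\geq 1\}$ be i.i.d. random variables with density $f_{\nu,h,\lambda}(t)=\lambda^h t^{\nu h-1}E_{\nu,\nu h}^h(-\lambda t^\nu)1_{(0,\infty)}(t)$, and let $M_{\nu,h,\lambda}(t):=\sum_{n\geq 1}1_{T_1^{(\nu)}+\cdots+T_n^{(\nu)}\leq t}$ for $t\geq 0$. Let $\{U_k:k\geq 1\}$ be i.i.d. positive random variables, independent of $\{M_{\nu,h,\lambda}(t):t\geq 0\}$. For $u>0$ let $$\Psi(u):=P\left(\exists\, t\geq 0: R(t)<0\right),\qquad R(t):=u+ct-\sum_{k=1}^{M_{\nu,h,\lambda}(t)}U_k .$$ Define $$\tilde{\kappa}_\nu(\theta):=\log\mathbb{E}[e^{\theta U_1}]+\log\mathbb{E}[e^{-c\theta T_1^{(\nu)}}],\qquad \theta\in\mathbb{R},$$ and assume that there exists $w_{\nu,h,\lambda}\in(0,\infty)\cap\{\theta\in\mathbb{R}:\tilde{\kappa}_\nu(\theta)<\infty\}^\circ$ such that $\tilde{\kappa}_\nu(w_{\nu,h,\lambda})=0$. Then $$\lim_{u\to\infty}\frac{1}{u}\log\Psi(u)=-w_{\nu,h,\lambda}.$$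
   Context: Generalized Mittag-Leffler function: $E_{\alpha,\beta}^\gamma(x):=\sum_{r\geq 0}\frac{(\gamma)_r x^r}{r!\,\Gamma(\alpha r+\beta)}$, where $(\gamma)_0:=1$ and $(\gamma)_r:=\gamma(\gamma+1)\cdots(\gamma+r-1)$ for $r\geq 1$. $A^\circ$ denotes the interior of $A\subset\mathbb{R}$. It is known that $f_{\nu,h,\lambda}$ is a probability density and that, for $\nu\in(0,1)$, $\log\mathbb{E}[e^{\theta T_1^{(\nu)}}]=h\log\frac{\lambda}{\lambda+(-\theta)^\nu}$ if $\theta\leq 0$ and $=\infty$ if $\theta>0$. Interpretation: $\{R(t):t\geq 0\}$ is the reserve process of an insurance company with initial capital $u$, premium rate $c$, claim sizes $\{U_k\}$, and claim number process $\{M_{\nu,h,\lambda}(t)\}$; $\Psi(u)$ is the ruin probability. *)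

theory Defs
  imports "HOL-Probability.Probability"
begin

definition gen_mittag_leffler :: "real \<Rightarrow> real \<Rightarrow> real \<Rightarrow> real \<Rightarrow> real" where
  "gen_mittag_leffler \<alpha> \<beta> \<gamma> x =
     (\<Sum>r. pochhammer \<gamma> r * x ^ r / (fact r * Gamma (\<alpha> * real r + \<beta>)))"

definition waiting_density :: "real \<Rightarrow> real \<Rightarrow> real \<Rightarrow> real \<Rightarrow> real" where
  "waiting_density \<nu> h lam t =
     lam powr h * t powr (\<nu> * h - 1) * gen_mittag_leffler \<nu> (\<nu> * h) h (- lam * t powr \<nu>)
       * indicator {0<..} t"

(* Waiting times and claims are indexed from 1 as in the mathematics; the value at 0 is unused.
   The count is ennreal-valued, so it is infinity (not 0) on the null event that infinitely many
   arrivals occur by time t. *)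
definition renewal_count :: "(nat \<Rightarrow> 'a \<Rightarrow> real) \<Rightarrow> real \<Rightarrow> 'a \<Rightarrow> ennreal" where
  "renewal_count T t \<omega> = (\<Sum>n. indicator {s. s \<le> t} (\<Sum>i=1..Suc n. T i \<omega>))"

(* The sum of the first N claims, also meaningful for N = infinity. Claims are nonnegative almost
   surely, so the truncation of negative reals by ennreal only acts on a null set. *)
definition total_claims :: "(nat \<Rightarrow> 'a \<Rightarrow> real) \<Rightarrow> ennreal \<Rightarrow> 'a \<Rightarrow> ennreal" where
  "total_claims U N \<omega> = (\<Sum>k. if of_nat (Suc k) \<le> N then ennreal (U (Suc k) \<omega>) else 0)"

definition reserve ::
  "(nat \<Rightarrow> 'a \<Rightarrow> real) \<Rightarrow> (nat \<Rightarrow> 'a \<Rightarrow> real) \<Rightarrow> real \<Rightarrow> real \<Rightarrow> real \<Rightarrow> 'a \<Rightarrow> ereal" where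
  "reserve T U c u t \<omega> =
     ereal (u + c * t) - enn2ereal (total_claims U (renewal_count T t \<omega>) \<omega>)"

definition ruin_prob ::
  "'a measure \<Rightarrow> (nat \<Rightarrow> 'a \<Rightarrow> real) \<Rightarrow> (nat \<Rightarrow> 'a \<Rightarrow> real) \<Rightarrow> real \<Rightarrow> real \<Rightarrow> real" where
  "ruin_prob P T U c u = measure P {\<omega> \<in> space P. \<exists>t\<ge>0. reserve T U c u t \<omega> < 0}"

definition ennreal_log :: "ennreal \<Rightarrow> ereal" where
  "ennreal_log x =
     (if x = 0 then -\<infinity> else if x = \<infinity> then \<infinity> else ereal (ln (enn2real x)))"

definition log_mgf :: "'a measure \<Rightarrow> ('a \<Rightarrow> real) \<Rightarrow> real \<Rightarrow> ereal" where
  "log_mgf P X \<theta> = ennreal_log (\<integral>\<^sup>+ \<omega>. ennreal (exp (\<theta> * X \<omega>)) \<partial>P)"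

(* No clash of infinities: on a probability space neither summand is -infinity. *)
definition kappa ::
  "'a measure \<Rightarrow> (nat \<Rightarrow> 'a \<Rightarrow> real) \<Rightarrow> (nat \<Rightarrow> 'a \<Rightarrow> real) \<Rightarrow> real \<Rightarrow> real \<Rightarrow> ereal" where
  "kappa P T U c \<theta> = log_mgf P (U 1) \<theta> + log_mgf P (T 1) (- c * \<theta>)"

definition generated_events ::
  "'a measure \<Rightarrow> 'i set \<Rightarrow> ('i \<Rightarrow> 'a \<Rightarrow> 'b::topological_space) \<Rightarrow> 'a set set" where
  "generated_events P I X =
     sets (vimage_algebra (space P) (\<lambda>\<omega>. \<lambda>i\<in>I. X i \<omega>) (\<Pi>\<^sub>M i\<in>I. borel))"

end

theory Submission
  imports Defs
begin

text \<open>
  Ruin can only occur at an arrival, so up to a null event it means that the random walk \<open>S n\<close> with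
  increments \<open>X i = U i - c * T i\<close> exceeds \<open>u\<close> for some \<open>n \<ge> 1\<close>, and the hypothesis on \<open>w\<close> says that
  \<open>exp (w * X i)\<close> has expectation 1. For \<open>0 < \<theta> < w\<close> strict convexity makes the expectation of
  \<open>exp (\<theta> * X i)\<close> less than 1, so Markov's inequality and a union bound over \<open>n\<close> bound the ruin
  probability by a multiple of \<open>exp (- \<theta> * u)\<close>. For the lower bound the law of \<open>S n\<close> is tilted by
  \<open>exp (w * S n)\<close>: the tilted drift \<open>\<mu>\<close> is positive, Chebyshev's inequality concentrates \<open>S n\<close> near
  \<open>n * \<mu>\<close>, and undoing the tilt at \<open>n\<close> about \<open>u / \<mu>\<close> costs a factor of about \<open>exp (- w * u)\<close>.
\<close>

section \<open>Large deviations of the maximum of a random walk\<close>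

text \<open>The tangent at \<open>p * x\<close> lies strictly below the graph at \<open>x\<close>
  and at \<open>0\<close>; averaging the two tangent inequalities with weights \<open>p\<close> and
  \<open>1 - p\<close> cancels the slope.\<close>

lemma exp_chord_strict:
  fixes p x :: real
  assumes "0 < p" "p < 1" "x \<noteq> 0"
  shows "exp (p * x) < p * exp x + (1 - p)"
proof -
  have tangent: "1 + z < exp z" if "z \<noteq> 0" for z :: real
    using that exp_minus_greater[of "-z"] by simp
  let ?a = "p * x"
  have "exp ?a * (1 + (x - ?a)) < exp ?a * exp (x - ?a)"
    using assms by (intro mult_strict_left_mono tangent) (auto simp: algebra_simps)
  then have 1: "exp ?a * (1 + (x - ?a)) < exp x"
    by (simp flip: exp_add)
  have "exp ?a * (1 - ?a) < exp ?a * exp (- ?a)"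
    using assms tangent[of "- ?a"] by (intro mult_strict_left_mono) auto
  then have 2: "exp ?a * (1 - ?a) < 1"
    by (simp flip: exp_add)
  have "exp ?a = p * (exp ?a * (1 + (x - ?a))) + (1 - p) * (exp ?a * (1 - ?a))"
    by (simp add: algebra_simps)
  also have "\<dots> < p * exp x + (1 - p) * 1"
    using assms 1 2 by (intro add_strict_mono mult_strict_left_mono) auto
  finally show ?thesis by simp
qed

text \<open>Since \<open>z\<^sup>2 / 2 \<le> exp z\<close> for \<open>z \<ge> 0\<close>, the square
  is absorbed by \<open>exp (d * x)\<close> on the right half-line and by the decay of
  \<open>exp (w * x)\<close> on the left one. This gives the tilted law a second moment.\<close>

lemma square_times_exp_le:
  fixes w d x :: real
  assumes "0 < w" "0 < d"
  shows "x\<^sup>2 * exp (w * x) \<le> (2 / d\<^sup>2) * exp ((w + d) * x) + 2 / w\<^sup>2"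
proof (cases "x \<ge> 0")
  case True
  have "(d * x)\<^sup>2 / 2 \<le> exp (d * x)"
    using exp_lower_Taylor_quadratic[of "d * x"] True assms mult_nonneg_nonneg[of d x] by linarith
  then have "x\<^sup>2 \<le> 2 / d\<^sup>2 * exp (d * x)"
    using assms by (simp add: field_simps power2_eq_square)
  then have "x\<^sup>2 * exp (w * x) \<le> 2 / d\<^sup>2 * exp (d * x) * exp (w * x)"
    by (intro mult_right_mono) auto
  also have "\<dots> = (2 / d\<^sup>2) * exp ((w + d) * x)"
    by (simp add: algebra_simps flip: exp_add)
  finally show ?thesis using assms by (smt (verit) divide_nonneg_nonneg zero_le_power2)
next
  case False
  have "(- w * x)\<^sup>2 / 2 \<le> exp (- w * x)"
    using exp_lower_Taylor_quadratic[of "- w * x"] False assms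
      mult_pos_neg[of w x] by auto
  then have "x\<^sup>2 \<le> 2 / w\<^sup>2 * exp (- w * x)"
    using assms by (simp add: field_simps power2_eq_square)
  then have "x\<^sup>2 * exp (w * x) \<le> 2 / w\<^sup>2 * exp (- w * x) * exp (w * x)"
    by (intro mult_right_mono) auto
  also have "\<dots> = 2 / w\<^sup>2"
    by (simp flip: exp_add)
  finally show ?thesis using assms by (smt (verit) divide_nonneg_nonneg zero_le_power2 exp_gt_zero mult_nonneg_nonneg)
qed

text \<open>\<open>d\<close> is the room to the right of \<open>w\<close> that the interior
  condition provides. \<open>nondegenerate\<close> excludes the walk that stays at 0, which
  satisfies \<open>mgf_one\<close> for every \<open>w\<close>; it makes the convexity inequalities
  strict in expectation.\<close>

locale tilted_walk = prob_space +
  fixes X :: "nat \<Rightarrow> 'a \<Rightarrow> real" and w d :: real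
  assumes indep: "indep_vars (\<lambda>_. borel) X {1..}"
    and ident: "\<And>k. k \<ge> 1 \<Longrightarrow> distr M borel (X k) = distr M borel (X 1)"
    and w_pos: "0 < w" and d_pos: "0 < d"
    and exp_integrable: "integrable M (\<lambda>\<omega>. exp ((w + d) * X 1 \<omega>))"
    and mgf_one: "expectation (\<lambda>\<omega>. exp (w * X 1 \<omega>)) = 1"
    and nondegenerate: "\<not> (AE \<omega> in M. X 1 \<omega> = 0)"
begin

declare One_nat_def [simp del]

definition S :: "nat \<Rightarrow> 'a \<Rightarrow> real" where
  "S n \<omega> = (\<Sum>i=1..n. X i \<omega>)"

lemma X_measurable [measurable]: "k \<ge> 1 \<Longrightarrow> X k \<in> borel_measurable M"
  using indep by (auto simp: indep_vars_def)

lemma X_Suc_measurable [measurable]: "X (Suc n) \<in> borel_measurable M"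
  by (rule X_measurable) simp

lemma S_measurable [measurable]: "S n \<in> borel_measurable M"
  unfolding S_def[abs_def] by (intro borel_measurable_sum) auto

lemma S_Suc: "S (Suc n) \<omega> = S n \<omega> + X (Suc n) \<omega>"
  by (simp add: S_def)

lemma
  assumes "k \<ge> 1" and [measurable]: "g \<in> borel_measurable borel"
    and "integrable M (\<lambda>\<omega>. g (X 1 \<omega>) :: real)"
  shows integrable_ident: "integrable M (\<lambda>\<omega>. g (X k \<omega>))"
    and expectation_ident: "expectation (\<lambda>\<omega>. g (X k \<omega>)) = expectation (\<lambda>\<omega>. g (X 1 \<omega>))"
proof -
  note [measurable] = X_measurable[OF assms(1)] X_measurable[OF order.refl]
  show "integrable M (\<lambda>\<omega>. g (X k \<omega>))"
    using assms(3) integrable_distr_eq[of "X k" M borel g] integrable_distr_eq[of "X 1" M borel g]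
    by (simp add: ident[OF assms(1)])
  show "expectation (\<lambda>\<omega>. g (X k \<omega>)) = expectation (\<lambda>\<omega>. g (X 1 \<omega>))"
    using integral_distr[of "X k" M borel g] integral_distr[of "X 1" M borel g]
    by (simp add: ident[OF assms(1)])
qed

text \<open>The integral of a non-integrable function is 0 by convention, so the value 1 forces
  integrability.\<close>

lemma exp_w_integrable: "integrable M (\<lambda>\<omega>. exp (w * X 1 \<omega>))"
  using mgf_one not_integrable_integral_eq by fastforce

text \<open>\<theta> is a convex combination of 0 and \<open>w\<close>, where the moment generating
  function equals 1. The pointwise chord bound is strict where \<open>X 1\<close> is nonzero, a set
  of positive probability.\<close>

lemma mgf_less_one:
  assumes "0 < \<theta>" "\<theta> < w"
  shows "integrable M (\<lambda>\<omega>. exp (\<theta> * X 1 \<omega>))" "expectation (\<lambda>\<omega>. exp (\<theta> * X 1 \<omega>)) < 1"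
proof -
  define p where "p = \<theta> / w"
  have p: "0 < p" "p < 1" "\<theta> = p * w"
    using assms w_pos by (auto simp: p_def)
  have less: "exp (\<theta> * X 1 \<omega>) < p * exp (w * X 1 \<omega>) + (1 - p)" if "X 1 \<omega> \<noteq> 0" for \<omega>
    using exp_chord_strict[of p "w * X 1 \<omega>"] p that w_pos by (simp add: mult.assoc)
  have le: "exp (\<theta> * X 1 \<omega>) \<le> p * exp (w * X 1 \<omega>) + (1 - p)" for \<omega>
    using less[of \<omega>] by (cases "X 1 \<omega> = 0") auto
  have int: "integrable M (\<lambda>\<omega>. p * exp (w * X 1 \<omega>) + (1 - p))"
    using exp_w_integrable by auto
  show int': "integrable M (\<lambda>\<omega>. exp (\<theta> * X 1 \<omega>))"
    by (rule Bochner_Integration.integrable_bound[OF int])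
       (use order_trans[OF le abs_ge_self] in \<open>auto intro!: AE_I2\<close>)
  let ?A = "{\<omega> \<in> space M. X 1 \<omega> \<noteq> 0}"
  have "emeasure M ?A \<noteq> 0"
    using nondegenerate by (subst (asm) AE_iff_measurable[OF _ refl]) auto
  then have "expectation (\<lambda>\<omega>. exp (\<theta> * X 1 \<omega>)) < expectation (\<lambda>\<omega>. p * exp (w * X 1 \<omega>) + (1 - p))"
    using less le by (intro integral_less_AE[where A = ?A] int int' AE_I2) (auto simp: less_imp_neq)
  also have "\<dots> = 1"
    using exp_w_integrable mgf_one by (simp add: prob_space)
  finally show "expectation (\<lambda>\<omega>. exp (\<theta> * X 1 \<omega>)) < 1" .
qed

lemma
  assumes "integrable M (\<lambda>\<omega>. exp (\<theta> * X 1 \<omega>))"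
  shows exp_S_integrable: "integrable M (\<lambda>\<omega>. exp (\<theta> * S n \<omega>))"
    and expectation_exp_S: "expectation (\<lambda>\<omega>. exp (\<theta> * S n \<omega>)) = expectation (\<lambda>\<omega>. exp (\<theta> * X 1 \<omega>)) ^ n"
proof -
  have eq: "exp (\<theta> * S n \<omega>) = (\<Prod>i\<in>{1..n}. exp (\<theta> * X i \<omega>))" for \<omega>
    by (simp add: S_def sum_distrib_left exp_sum)
  have ind: "indep_vars (\<lambda>_. borel) (\<lambda>i \<omega>. exp (\<theta> * X i \<omega>)) {1..n}"
    by (rule indep_vars_compose2[OF indep_vars_subset[OF indep]]) auto
  have int: "integrable M (\<lambda>\<omega>. exp (\<theta> * X i \<omega>))" if "i \<in> {1..n}" for i
    using integrable_ident[of i "\<lambda>x. exp (\<theta> * x)"] that assms by auto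
  show "integrable M (\<lambda>\<omega>. exp (\<theta> * S n \<omega>))"
    unfolding eq using ind int by (intro indep_vars_integrable) auto
  have "expectation (\<lambda>\<omega>. exp (\<theta> * S n \<omega>)) = (\<Prod>i\<in>{1..n}. expectation (\<lambda>\<omega>. exp (\<theta> * X i \<omega>)))"
    unfolding eq using ind int by (intro indep_vars_lebesgue_integral) auto
  also have "\<dots> = (\<Prod>i\<in>{1..n}. expectation (\<lambda>\<omega>. exp (\<theta> * X 1 \<omega>)))"
    by (intro prod.cong refl expectation_ident[where g = "\<lambda>x. exp (\<theta> * x)"] assms) auto
  finally show "expectation (\<lambda>\<omega>. exp (\<theta> * S n \<omega>)) = expectation (\<lambda>\<omega>. exp (\<theta> * X 1 \<omega>)) ^ n"
    by simp
qed

section \<open>Exponential upper bound\<close>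

abbreviation exceed :: "real \<Rightarrow> 'a set" where
  "exceed u \<equiv> {\<omega> \<in> space M. \<exists>n\<ge>1. S n \<omega> > u}"

text \<open>The exponential Markov bounds for the single \<open>n\<close> form a geometric series
  with ratio \<open>m < 1\<close>, whence the constant \<open>1 / (1 - m)\<close>.\<close>

lemma prob_exceed_upper:
  assumes "0 < \<theta>" "\<theta> < w"
  shows "\<exists>C>0. \<forall>u. prob (exceed u) \<le> C * exp (- \<theta> * u)"
proof -
  define m where "m = expectation (\<lambda>\<omega>. exp (\<theta> * X 1 \<omega>))"
  note int = mgf_less_one(1)[OF assms]
  have m: "0 \<le> m" "m < 1"
    using mgf_less_one(2)[OF assms] by (auto simp: m_def)
  have bound: "prob {\<omega> \<in> space M. S n \<omega> > u} \<le> exp (- \<theta> * u) * m ^ n" for n u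
  proof -
    have "prob {\<omega> \<in> space M. S n \<omega> > u} \<le> prob {\<omega> \<in> space M. exp (\<theta> * S n \<omega>) \<ge> exp (\<theta> * u)}"
      using assms by (intro finite_measure_mono) auto
    also have "\<dots> \<le> expectation (\<lambda>\<omega>. exp (\<theta> * S n \<omega>)) / exp (\<theta> * u)"
      by (rule integral_Markov_inequality_measure[where A = "{}"]) (auto intro: exp_S_integrable int)
    also have "\<dots> = exp (- \<theta> * u) * m ^ n"
      unfolding expectation_exp_S[OF int] m_def[symmetric] by (simp add: exp_minus field_simps)
    finally show ?thesis .
  qed
  have "prob (exceed u) \<le> 1 / (1 - m) * exp (- \<theta> * u)" for u
  proof -
    have summ: "summable (\<lambda>n. exp (- \<theta> * u) * m ^ n)"
      using m by (intro summable_mult summable_geometric) auto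
    have summ': "summable (\<lambda>n. prob {\<omega> \<in> space M. S n \<omega> > u})"
      by (rule summable_comparison_test'[OF summ, of 0]) (use bound in auto)
    have "prob (exceed u) \<le> prob (\<Union>n. {\<omega> \<in> space M. S n \<omega> > u})"
      by (intro finite_measure_mono) auto
    also have "\<dots> \<le> (\<Sum>n. prob {\<omega> \<in> space M. S n \<omega> > u})"
      by (intro finite_measure_subadditive_countably summ') auto
    also have "\<dots> \<le> (\<Sum>n. exp (- \<theta> * u) * m ^ n)"
      by (intro suminf_le bound summ summ')
    also have "\<dots> = 1 / (1 - m) * exp (- \<theta> * u)"
      using m by (subst suminf_mult) (auto simp: suminf_geometric)
    finally show ?thesis .
  qed
  then show ?thesis
    using m by (intro exI[of _ "1 / (1 - m)"]) auto
qed

section \<open>Moments under the tilted law\<close>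

text \<open>Under the tilted measure with density \<open>exp (w * S n)\<close> the walk has drift \<open>\<mu>\<close>
  and variance \<open>\<sigma>2\<close> per step.\<close>

definition \<mu> :: real where
  "\<mu> = expectation (\<lambda>\<omega>. X 1 \<omega> * exp (w * X 1 \<omega>))"

definition \<sigma>2 :: real where
  "\<sigma>2 = expectation (\<lambda>\<omega>. (X 1 \<omega> - \<mu>)\<^sup>2 * exp (w * X 1 \<omega>))"

lemma tilted_moments_integrable:
  shows square_tilted_integrable: "integrable M (\<lambda>\<omega>. (X 1 \<omega>)\<^sup>2 * exp (w * X 1 \<omega>))"
    and tilted_integrable: "integrable M (\<lambda>\<omega>. X 1 \<omega> * exp (w * X 1 \<omega>))"
proof -
  have "integrable M (\<lambda>\<omega>. (2 / d\<^sup>2) * exp ((w + d) * X 1 \<omega>) + 2 / w\<^sup>2)"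
    using exp_integrable by auto
  then show 2: "integrable M (\<lambda>\<omega>. (X 1 \<omega>)\<^sup>2 * exp (w * X 1 \<omega>))"
    by (rule Bochner_Integration.integrable_bound)
       (auto intro!: AE_I2 order_trans[OF square_times_exp_le[OF w_pos d_pos]])
  \<comment> \<open>The square of \<open>\<bar>x\<bar> - 1 / 2\<close> is nonnegative; this lets the
    second tilted moment together with the total mass dominate the first.\<close>
  have abs_le: "\<bar>x\<bar> \<le> x\<^sup>2 + 1" for x :: real
    using zero_le_power2[of "\<bar>x\<bar> - 1 / 2"] by (simp add: power2_diff power_divide)
  have "integrable M (\<lambda>\<omega>. (X 1 \<omega>)\<^sup>2 * exp (w * X 1 \<omega>) + exp (w * X 1 \<omega>))"
    using 2 exp_w_integrable by auto
  then show "integrable M (\<lambda>\<omega>. X 1 \<omega> * exp (w * X 1 \<omega>))"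
  proof (rule Bochner_Integration.integrable_bound)
    show "AE \<omega> in M. norm (X 1 \<omega> * exp (w * X 1 \<omega>)) \<le> norm ((X 1 \<omega>)\<^sup>2 * exp (w * X 1 \<omega>) + exp (w * X 1 \<omega>))"
      using mult_right_mono[OF abs_le exp_ge_zero]
      by (intro AE_I2) (simp add: abs_mult algebra_simps)
  qed auto
qed

text \<open>By convexity, a moment generating function equal to 1 at both 0 and \<open>w\<close> has
  positive slope at \<open>w\<close>. The pointwise form is \<open>exp z - 1 < z * exp z\<close> for
  \<open>z = w * X 1 \<omega>\<close> nonzero; its left side has expectation 0 and its right side
  \<open>w * \<mu>\<close>.\<close>

lemma \<mu>_pos: "0 < \<mu>"
proof -
  let ?f = "\<lambda>\<omega>. exp (w * X 1 \<omega>) - 1" and ?g = "\<lambda>\<omega>. w * (X 1 \<omega> * exp (w * X 1 \<omega>))"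
  let ?A = "{\<omega> \<in> space M. X 1 \<omega> \<noteq> 0}"
  have less: "?f \<omega> < ?g \<omega>" if "X 1 \<omega> \<noteq> 0" for \<omega>
  proof -
    have "1 - w * X 1 \<omega> < exp (- (w * X 1 \<omega>))"
      using that w_pos exp_minus_greater[of "w * X 1 \<omega>"] by simp
    then have "(1 - w * X 1 \<omega>) * exp (w * X 1 \<omega>) < exp (- (w * X 1 \<omega>)) * exp (w * X 1 \<omega>)"
      by (intro mult_strict_right_mono) auto
    then show ?thesis by (simp add: algebra_simps flip: exp_add)
  qed
  have "emeasure M ?A \<noteq> 0"
    using nondegenerate by (subst (asm) AE_iff_measurable[OF _ refl]) auto
  moreover have "?f \<omega> \<le> ?g \<omega>" for \<omega>
    using less[of \<omega>] by (cases "X 1 \<omega> = 0") auto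
  ultimately have "expectation ?f < expectation ?g"
    using less exp_w_integrable tilted_integrable
    by (intro integral_less_AE[where A = ?A] AE_I2) (auto simp: less_imp_neq)
  then show ?thesis
    using exp_w_integrable w_pos by (simp add: mgf_one prob_space \<mu>_def zero_less_mult_iff)
qed

text \<open>\<open>S n\<close> involves only the first \<open>n\<close> increments and so is
  independent of the next one. With the tilt factored along the same split, this drives the
  induction for the tilted moments.\<close>

lemma expectation_step:
  assumes [measurable]: "f \<in> borel_measurable borel" "g \<in> borel_measurable borel"
    and "integrable M (\<lambda>\<omega>. f (S n \<omega>) :: real)" "integrable M (\<lambda>\<omega>. g (X 1 \<omega>) :: real)"
  shows "integrable M (\<lambda>\<omega>. f (S n \<omega>) * g (X (Suc n) \<omega>))"
    and "expectation (\<lambda>\<omega>. f (S n \<omega>) * g (X (Suc n) \<omega>))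
      = expectation (\<lambda>\<omega>. f (S n \<omega>)) * expectation (\<lambda>\<omega>. g (X 1 \<omega>))"
proof -
  have "indep_var borel (X (Suc n)) borel (S n)"
    unfolding S_def[abs_def]
    by (rule indep_vars_sum[OF _ _ indep_vars_subset[OF indep]]) auto
  then have ind: "indep_var borel (\<lambda>\<omega>. g (X (Suc n) \<omega>)) borel (\<lambda>\<omega>. f (S n \<omega>))"
    using indep_var_compose[of borel "X (Suc n)" borel "S n" g borel f borel] by (simp add: comp_def)
  have int: "integrable M (\<lambda>\<omega>. g (X (Suc n) \<omega>))"
    using integrable_ident[of "Suc n" g] assms by simp
  show "integrable M (\<lambda>\<omega>. f (S n \<omega>) * g (X (Suc n) \<omega>))"
    using indep_var_integrable[OF ind int assms(3)] by (simp add: mult.commute)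
  show "expectation (\<lambda>\<omega>. f (S n \<omega>) * g (X (Suc n) \<omega>))
      = expectation (\<lambda>\<omega>. f (S n \<omega>)) * expectation (\<lambda>\<omega>. g (X 1 \<omega>))"
    using indep_var_lebesgue_integral[OF ind int assms(3)] expectation_ident[of "Suc n" g] assms
    by (simp add: mult.commute)
qed

text \<open>Mean and variance are carried through one induction because the variance step uses the
  vanishing mean: the cross term is the product of two centred first moments, hence 0, and each step
  adds \<sigma>2.\<close>

lemma tilted_S_moments:
  defines "Y \<equiv> \<lambda>n \<omega>. S n \<omega> - real n * \<mu>"
  shows "integrable M (\<lambda>\<omega>. Y n \<omega> * exp (w * S n \<omega>)) \<and>
    expectation (\<lambda>\<omega>. Y n \<omega> * exp (w * S n \<omega>)) = 0 \<and>
    integrable M (\<lambda>\<omega>. (Y n \<omega>)\<^sup>2 * exp (w * S n \<omega>)) \<and>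
    expectation (\<lambda>\<omega>. (Y n \<omega>)\<^sup>2 * exp (w * S n \<omega>)) = real n * \<sigma>2"
proof (induction n)
  case 0
  show ?case by (simp add: Y_def S_def)
next
  case (Suc n)
  \<comment> \<open>Centred powers weighted by the tilt; the exponent 0 leaves the tilt alone, whose
    expectation is 1.\<close>
  let ?f = "\<lambda>k s. (s - real n * \<mu>) ^ k * exp (w * s)"
  let ?g = "\<lambda>k x. (x - \<mu>) ^ k * exp (w * x)"
  have f0: "integrable M (\<lambda>\<omega>. ?f 0 (S n \<omega>))" "expectation (\<lambda>\<omega>. ?f 0 (S n \<omega>)) = 1"
    using exp_S_integrable[OF exp_w_integrable, of n] expectation_exp_S[OF exp_w_integrable, of n]
    by (simp_all add: mgf_one)
  have f1: "integrable M (\<lambda>\<omega>. ?f 1 (S n \<omega>))" "expectation (\<lambda>\<omega>. ?f 1 (S n \<omega>)) = 0"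
    and f2: "integrable M (\<lambda>\<omega>. ?f 2 (S n \<omega>))" "expectation (\<lambda>\<omega>. ?f 2 (S n \<omega>)) = real n * \<sigma>2"
    using Suc by (simp_all add: Y_def)
  have g0: "integrable M (\<lambda>\<omega>. ?g 0 (X 1 \<omega>))" "expectation (\<lambda>\<omega>. ?g 0 (X 1 \<omega>)) = 1"
    using exp_w_integrable mgf_one by simp_all
  have "(\<lambda>\<omega>. ?g 1 (X 1 \<omega>)) = (\<lambda>\<omega>. X 1 \<omega> * exp (w * X 1 \<omega>) - \<mu> * exp (w * X 1 \<omega>))"
    by (simp add: algebra_simps)
  then have g1: "integrable M (\<lambda>\<omega>. ?g 1 (X 1 \<omega>))" "expectation (\<lambda>\<omega>. ?g 1 (X 1 \<omega>)) = 0"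
    using tilted_integrable exp_w_integrable by (simp_all add: mgf_one \<mu>_def[symmetric])
  have "(\<lambda>\<omega>. ?g 2 (X 1 \<omega>)) = (\<lambda>\<omega>. (X 1 \<omega>)\<^sup>2 * exp (w * X 1 \<omega>)
      - 2 * \<mu> * (X 1 \<omega> * exp (w * X 1 \<omega>)) + \<mu>\<^sup>2 * exp (w * X 1 \<omega>))"
    by (simp add: algebra_simps power2_eq_square)
  then have g2: "integrable M (\<lambda>\<omega>. ?g 2 (X 1 \<omega>))" "expectation (\<lambda>\<omega>. ?g 2 (X 1 \<omega>)) = \<sigma>2"
    using tilted_integrable exp_w_integrable square_tilted_integrable by (simp_all add: \<sigma>2_def)
  have prod: "integrable M (\<lambda>\<omega>. ?f j (S n \<omega>) * ?g k (X (Suc n) \<omega>))"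
    "expectation (\<lambda>\<omega>. ?f j (S n \<omega>) * ?g k (X (Suc n) \<omega>))
      = expectation (\<lambda>\<omega>. ?f j (S n \<omega>)) * expectation (\<lambda>\<omega>. ?g k (X 1 \<omega>))"
    if "integrable M (\<lambda>\<omega>. ?f j (S n \<omega>))" "integrable M (\<lambda>\<omega>. ?g k (X 1 \<omega>))" for j k
    using expectation_step[of "?f j" "?g k" n] that by simp_all
  have Y: "Y (Suc n) \<omega> = (S n \<omega> - real n * \<mu>) + (X (Suc n) \<omega> - \<mu>)" for \<omega>
    by (simp add: Y_def S_Suc algebra_simps)
  have e: "exp (w * S (Suc n) \<omega>) = exp (w * S n \<omega>) * exp (w * X (Suc n) \<omega>)" for \<omega>
    by (simp add: S_Suc algebra_simps flip: exp_add)
  have 1: "(\<lambda>\<omega>. Y (Suc n) \<omega> * exp (w * S (Suc n) \<omega>)) = (\<lambda>\<omega>.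
      ?f 1 (S n \<omega>) * ?g 0 (X (Suc n) \<omega>) + ?f 0 (S n \<omega>) * ?g 1 (X (Suc n) \<omega>))"
    unfolding Y e by (simp add: algebra_simps)
  have 2: "(\<lambda>\<omega>. (Y (Suc n) \<omega>)\<^sup>2 * exp (w * S (Suc n) \<omega>)) = (\<lambda>\<omega>.
      ?f 2 (S n \<omega>) * ?g 0 (X (Suc n) \<omega>) + 2 * (?f 1 (S n \<omega>) * ?g 1 (X (Suc n) \<omega>))
      + ?f 0 (S n \<omega>) * ?g 2 (X (Suc n) \<omega>))"
    unfolding Y e power2_sum by (simp add: algebra_simps)
  note integ = prod(1)[OF f0(1) g1(1)] prod(1)[OF f0(1) g2(1)] prod(1)[OF f1(1) g0(1)]
    prod(1)[OF f1(1) g1(1)] prod(1)[OF f2(1) g0(1)]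
  note expec = prod(2)[OF f0(1) g1(1)] prod(2)[OF f0(1) g2(1)] prod(2)[OF f1(1) g0(1)]
    prod(2)[OF f1(1) g1(1)] prod(2)[OF f2(1) g0(1)]
  have "expectation (\<lambda>\<omega>. Y (Suc n) \<omega> * exp (w * S (Suc n) \<omega>)) = 0"
    unfolding 1 Bochner_Integration.integral_add[OF integ(3,1)]
    unfolding expec f0 f1 g0 g1 by simp
  moreover have "expectation (\<lambda>\<omega>. (Y (Suc n) \<omega>)\<^sup>2 * exp (w * S (Suc n) \<omega>)) = real (Suc n) * \<sigma>2"
    unfolding 2 Bochner_Integration.integral_add[OF Bochner_Integration.integrable_add[OF integ(5)
        Bochner_Integration.integrable_mult_right[OF integ(4), of 2]] integ(2)]
      Bochner_Integration.integral_add[OF integ(5)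
        Bochner_Integration.integrable_mult_right[OF integ(4), of 2]] integral_mult_right_zero
    unfolding expec f0 f1 f2 g0 g1 g2 by (simp add: algebra_simps)
  moreover have "integrable M (\<lambda>\<omega>. Y (Suc n) \<omega> * exp (w * S (Suc n) \<omega>))"
    unfolding 1 by (rule Bochner_Integration.integrable_add[OF integ(3,1)])
  moreover have "integrable M (\<lambda>\<omega>. (Y (Suc n) \<omega>)\<^sup>2 * exp (w * S (Suc n) \<omega>))"
    unfolding 2 by (intro Bochner_Integration.integrable_add Bochner_Integration.integrable_mult_right integ)
  ultimately show ?case by blast
qed

section \<open>Lower bound by undoing the tilt\<close>

text \<open>This is Chebyshev's inequality under the tilted law, whose total mass is 1: on
  \<open>?A\<close> the tilt is at most \<open>?K\<close>, and off \<open>?A\<close> the tilted mass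
  is at most \<open>\<sigma>2 / (real n * \<epsilon>\<^sup>2)\<close>. Dividing by \<open>?K\<close>
  returns to the original law.\<close>

lemma prob_near_drift_lower:
  assumes "0 < \<epsilon>" "n \<ge> 1"
  shows "exp (- w * (real n * (\<mu> + \<epsilon>))) * (1 - \<sigma>2 / (real n * \<epsilon>\<^sup>2))
    \<le> prob {\<omega> \<in> space M. \<bar>S n \<omega> - real n * \<mu>\<bar> < real n * \<epsilon>}"
    (is "_ \<le> prob ?A")
proof -
  let ?Y = "\<lambda>\<omega>. S n \<omega> - real n * \<mu>" and ?K = "exp (w * (real n * (\<mu> + \<epsilon>)))"
  have [measurable]: "?A \<in> events" by measurable
  \<comment> \<open>Off \<open>?A\<close> the quotient of squares is at least 1, so the second
    summand alone dominates the tilt.\<close>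
  have le: "exp (w * S n \<omega>) \<le> ?K * indicator ?A \<omega> + (?Y \<omega>)\<^sup>2 * exp (w * S n \<omega>) / (real n * \<epsilon>)\<^sup>2"
    if "\<omega> \<in> space M" for \<omega>
  proof (cases "\<omega> \<in> ?A")
    case True
    then have "S n \<omega> \<le> real n * (\<mu> + \<epsilon>)"
      by (auto simp: algebra_simps)
    then have "exp (w * S n \<omega>) \<le> ?K"
      using w_pos by simp
    with True show ?thesis by (simp add: add_increasing2)
  next
    case False
    then have "real n * \<epsilon> \<le> \<bar>?Y \<omega>\<bar>" using that by auto
    then have "(real n * \<epsilon>)\<^sup>2 \<le> (?Y \<omega>)\<^sup>2"
      using assms by (intro iffD1[OF abs_le_square_iff]) simp
    then have "1 \<le> (?Y \<omega>)\<^sup>2 / (real n * \<epsilon>)\<^sup>2" using assms by simp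
    then have "1 * exp (w * S n \<omega>) \<le> (?Y \<omega>)\<^sup>2 / (real n * \<epsilon>)\<^sup>2 * exp (w * S n \<omega>)"
      by (intro mult_right_mono) auto
    with False show ?thesis by simp
  qed
  have int2: "integrable M (\<lambda>\<omega>. (?Y \<omega>)\<^sup>2 * exp (w * S n \<omega>))"
    and exp2: "expectation (\<lambda>\<omega>. (?Y \<omega>)\<^sup>2 * exp (w * S n \<omega>)) = real n * \<sigma>2"
    using tilted_S_moments[of n] by simp_all
  have "1 = expectation (\<lambda>\<omega>. exp (w * S n \<omega>))"
    by (simp add: expectation_exp_S[OF exp_w_integrable] mgf_one)
  also have "\<dots> \<le> expectation (\<lambda>\<omega>. ?K * indicator ?A \<omega> + (?Y \<omega>)\<^sup>2 * exp (w * S n \<omega>) / (real n * \<epsilon>)\<^sup>2)"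
    using int2 exp_S_integrable[OF exp_w_integrable, of n] le
    by (intro integral_mono Bochner_Integration.integrable_add
        Bochner_Integration.integrable_mult_right integrable_divide integrable_real_indicator)
       (auto simp: emeasure_eq_measure)
  also have "\<dots> = ?K * prob ?A + real n * \<sigma>2 / (real n * \<epsilon>)\<^sup>2"
    using int2 by (subst Bochner_Integration.integral_add) (auto simp: exp2 emeasure_eq_measure intro!: integrable_real_indicator)
  also have "real n * \<sigma>2 / (real n * \<epsilon>)\<^sup>2 = \<sigma>2 / (real n * \<epsilon>\<^sup>2)"
    using assms by (simp add: power2_eq_square field_simps)
  finally have "1 - \<sigma>2 / (real n * \<epsilon>\<^sup>2) \<le> ?K * prob ?A" by simp
  then have "exp (- w * (real n * (\<mu> + \<epsilon>))) * (1 - \<sigma>2 / (real n * \<epsilon>\<^sup>2))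
      \<le> exp (- w * (real n * (\<mu> + \<epsilon>))) * (?K * prob ?A)"
    by (intro mult_left_mono) auto
  also have "\<dots> = prob ?A"
    by (simp add: mult.assoc[symmetric] flip: exp_add)
  finally show ?thesis .
qed

text \<open>If \<open>n * (\<mu> - \<epsilon>) \<ge> u\<close>, then staying within
  \<open>n * \<epsilon>\<close> of the drift line puts \<open>S n\<close> above \<open>u\<close>.
  The least such \<open>n\<close> is used, as the cost
  \<open>exp (- w * n * (\<mu> + \<epsilon>))\<close> grows with \<open>n\<close>.\<close>

lemma prob_exceed_lower:
  assumes "0 < \<epsilon>" "\<epsilon> < \<mu>"
  shows "\<exists>C>0. eventually (\<lambda>u. C * exp (- (w * (\<mu> + \<epsilon>) / (\<mu> - \<epsilon>)) * u) \<le> prob (exceed u)) at_top"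
proof (intro exI conjI)
  \<comment> \<open>The factor \<open>1 / 2\<close> pays for the Chebyshev error at large
    \<open>n\<close>, the exponential for rounding \<open>u / (\<mu> - \<epsilon>)\<close> up to an
    integer.\<close>
  let ?C = "1 / 2 * exp (- w * (\<mu> + \<epsilon>))"
  show "?C > 0" by simp
  have "eventually (\<lambda>n. 1 / 2 \<le> 1 - \<sigma>2 / (real n * \<epsilon>\<^sup>2)) at_top"
  proof -
    have "(\<lambda>n. 1 - \<sigma>2 / (real n * \<epsilon>\<^sup>2)) \<longlonglongrightarrow> 1 - 0"
      using assms by (intro tendsto_intros real_tendsto_divide_at_top[OF tendsto_const]
        filterlim_at_top_mult_tendsto_pos[OF tendsto_const _ filterlim_real_sequentially]) auto
    then have "eventually (\<lambda>n. 1 / 2 < 1 - \<sigma>2 / (real n * \<epsilon>\<^sup>2)) at_top"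
      by (rule order_tendstoD) simp
    then show ?thesis by eventually_elim simp
  qed
  then obtain N where N: "\<And>n. n \<ge> N \<Longrightarrow> 1 / 2 \<le> 1 - \<sigma>2 / (real n * \<epsilon>\<^sup>2)"
    by (auto simp: eventually_at_top_linorder)
  show "eventually (\<lambda>u. ?C * exp (- (w * (\<mu> + \<epsilon>) / (\<mu> - \<epsilon>)) * u) \<le> prob (exceed u)) at_top"
    \<comment> \<open>The threshold on \<open>u\<close> ensures \<open>n \<ge> N\<close>, and
      \<open>u > 0\<close> ensures \<open>n \<ge> 1\<close>.\<close>
    using eventually_ge_at_top[of "(\<mu> - \<epsilon>) * real N"] eventually_gt_at_top[of 0]
  proof eventually_elim
    case (elim u)
    define n where "n = nat \<lceil>u / (\<mu> - \<epsilon>)\<rceil>"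
    have n_ge: "u / (\<mu> - \<epsilon>) \<le> real n" and n_le: "real n \<le> u / (\<mu> - \<epsilon>) + 1"
      using elim assms by (auto simp: n_def real_nat_ceiling_ge)
    have u_le: "u \<le> real n * (\<mu> - \<epsilon>)"
      using n_ge assms by (simp add: field_simps)
    have "real N \<le> u / (\<mu> - \<epsilon>)"
      using elim assms by (simp add: field_simps)
    then have "n \<ge> N" using n_ge by linarith
    have "0 < u / (\<mu> - \<epsilon>)" using elim assms by simp
    then have "n \<ge> 1" using n_ge by linarith
    have "w * (real n * (\<mu> + \<epsilon>)) \<le> w * ((u / (\<mu> - \<epsilon>) + 1) * (\<mu> + \<epsilon>))"
      using n_le w_pos assms \<mu>_pos by (intro mult_left_mono mult_right_mono) auto
    then have "- w * (\<mu> + \<epsilon>) - (w * (\<mu> + \<epsilon>) / (\<mu> - \<epsilon>)) * u \<le> - w * (real n * (\<mu> + \<epsilon>))"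
      by (simp add: algebra_simps)
    then have "exp (- w * (\<mu> + \<epsilon>)) * exp (- (w * (\<mu> + \<epsilon>) / (\<mu> - \<epsilon>)) * u) \<le> exp (- w * (real n * (\<mu> + \<epsilon>)))"
      by (simp flip: exp_add)
    then have "?C * exp (- (w * (\<mu> + \<epsilon>) / (\<mu> - \<epsilon>)) * u) \<le> exp (- w * (real n * (\<mu> + \<epsilon>))) * (1 / 2)"
      by simp
    also have "\<dots> \<le> exp (- w * (real n * (\<mu> + \<epsilon>))) * (1 - \<sigma>2 / (real n * \<epsilon>\<^sup>2))"
      using N[OF \<open>n \<ge> N\<close>] by (intro mult_left_mono) auto
    also have "\<dots> \<le> prob {\<omega> \<in> space M. \<bar>S n \<omega> - real n * \<mu>\<bar> < real n * \<epsilon>}"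
      by (rule prob_near_drift_lower) (use assms \<open>n \<ge> 1\<close> in auto)
    also have "\<dots> \<le> prob (exceed u)"
    proof (rule finite_measure_mono)
      show "{\<omega> \<in> space M. \<bar>S n \<omega> - real n * \<mu>\<bar> < real n * \<epsilon>} \<subseteq> exceed u"
        using u_le \<open>n \<ge> 1\<close> by (auto simp: algebra_simps intro!: exI[of _ n])
    qed measurable
    finally show ?case .
  qed
qed

section \<open>Logarithmic asymptotics of the maximum\<close>

theorem log_prob_exceed_limit:
  "((\<lambda>u. 1 / u * ln (prob (exceed u))) \<longlongrightarrow> - w) at_top"
proof (rule order_tendstoI)
  fix a assume "- w < a"
  \<comment> \<open>The midpoint of \<open>- a\<close> and \<open>w\<close> lies strictly between
    them; the maximum with \<open>w / 2\<close> keeps \<theta> positive when \<open>a\<close> is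
    large.\<close>
  define \<theta> where "\<theta> = max (w / 2) ((w - a) / 2)"
  have \<theta>: "0 < \<theta>" "\<theta> < w" "- \<theta> < a"
    using \<open>- w < a\<close> w_pos by (auto simp: \<theta>_def max_def field_simps)
  obtain C where C: "C > 0" "\<And>u. prob (exceed u) \<le> C * exp (- \<theta> * u)"
    using prob_exceed_upper[OF \<theta>(1,2)] by blast
  \<comment> \<open>The lower bound at \<open>\<epsilon> = \<mu> / 2\<close> serves only to make the
    probability positive for large \<open>u\<close>, so that \<open>ln\<close> is monotone on the
    values compared.\<close>
  define K where "K = - (w * (\<mu> + \<mu> / 2) / (\<mu> - \<mu> / 2))"
  obtain C' where C': "C' > 0" "eventually (\<lambda>u. C' * exp (K * u) \<le> prob (exceed u)) at_top"
    using prob_exceed_lower[of "\<mu> / 2"] \<mu>_pos unfolding K_def by auto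
  have "((\<lambda>u. ln C / u - \<theta>) \<longlongrightarrow> 0 - \<theta>) at_top"
    by (intro tendsto_intros real_tendsto_divide_at_top[OF tendsto_const] filterlim_ident)
  then have "eventually (\<lambda>u. ln C / u - \<theta> < a) at_top"
    using \<theta> by (intro order_tendstoD(2)) auto
  then show "eventually (\<lambda>u. 1 / u * ln (prob (exceed u)) < a) at_top"
    using C'(2) eventually_gt_at_top[of 0]
  proof eventually_elim
    case (elim u)
    have "0 < prob (exceed u)"
      using C'(1) elim by (smt (verit) exp_gt_zero mult_pos_pos)
    then have "ln (prob (exceed u)) \<le> ln (C * exp (- \<theta> * u))"
      using C by (intro ln_mono) auto
    also have "\<dots> = ln C - \<theta> * u"
      using C by (simp add: ln_mult)
    finally have "1 / u * ln (prob (exceed u)) \<le> 1 / u * (ln C - \<theta> * u)"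
      using elim by (intro mult_left_mono) auto
    also have "\<dots> = ln C / u - \<theta>"
      using elim by (simp add: field_simps)
    finally show ?case using elim by simp
  qed
next
  fix a assume "a < - w"
  \<comment> \<open>The exponent of the lower bound tends to \<open>- w\<close> as \<epsilon>
    decreases to 0, so a small enough \<epsilon> puts it above \<open>a\<close>.\<close>
  have "((\<lambda>\<epsilon>. - (w * (\<mu> + \<epsilon>) / (\<mu> - \<epsilon>))) \<longlongrightarrow> - (w * (\<mu> + 0) / (\<mu> - 0))) (at_right 0)"
    using \<mu>_pos by (intro tendsto_intros) auto
  then have "eventually (\<lambda>\<epsilon>. a < - (w * (\<mu> + \<epsilon>) / (\<mu> - \<epsilon>))) (at_right 0)"
    using \<open>a < - w\<close> \<mu>_pos by (intro order_tendstoD(1)) auto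
  moreover have "eventually (\<lambda>\<epsilon>. \<epsilon> \<in> {0<..<\<mu>}) (at_right 0)"
    using \<mu>_pos by (rule eventually_at_right_real)
  ultimately have "eventually (\<lambda>\<epsilon>. a < - (w * (\<mu> + \<epsilon>) / (\<mu> - \<epsilon>)) \<and> \<epsilon> \<in> {0<..<\<mu>}) (at_right 0)"
    by eventually_elim simp
  then obtain \<epsilon> where \<epsilon>: "0 < \<epsilon>" "\<epsilon> < \<mu>" "a < - (w * (\<mu> + \<epsilon>) / (\<mu> - \<epsilon>))"
    using eventually_happens'[OF trivial_limit_at_right_real] by (metis (no_types, lifting) greaterThanLessThan_iff)
  define K where "K = - (w * (\<mu> + \<epsilon>) / (\<mu> - \<epsilon>))"
  obtain C where C: "C > 0" "eventually (\<lambda>u. C * exp (K * u) \<le> prob (exceed u)) at_top"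
    using prob_exceed_lower[OF \<epsilon>(1,2)] unfolding K_def by blast
  have "((\<lambda>u. ln C / u + K) \<longlongrightarrow> 0 + K) at_top"
    by (intro tendsto_intros real_tendsto_divide_at_top[OF tendsto_const] filterlim_ident)
  then have "eventually (\<lambda>u. a < ln C / u + K) at_top"
    using \<epsilon>(3) by (intro order_tendstoD(1)) (auto simp: K_def)
  then show "eventually (\<lambda>u. a < 1 / u * ln (prob (exceed u))) at_top"
    using C(2) eventually_gt_at_top[of 0]
  proof eventually_elim
    case (elim u)
    have "a < ln C / u + K" by (rule elim)
    also have "\<dots> = 1 / u * (ln C + K * u)"
      using elim by (simp add: field_simps)
    also have "ln C + K * u = ln (C * exp (K * u))"
      using C by (simp add: ln_mult)
    also have "1 / u * \<dots> \<le> 1 / u * ln (prob (exceed u))"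
      using elim C by (intro mult_left_mono ln_mono) auto
    finally show ?case .
  qed
qed

end

section \<open>Ruin in terms of the random walk\<close>

lemma renewal_count_mono: "s \<le> t \<Longrightarrow> renewal_count T s \<omega> \<le> renewal_count T t \<omega>"
  unfolding renewal_count_def by (intro suminf_le) (auto simp: indicator_def)

text \<open>Positive waiting times make the arrival times increase, so the arrivals up to
  \<open>t\<close> form an initial segment. Comparing with each finite \<open>n\<close> also covers
  an infinite count.\<close>

lemma renewal_count_ge_iff:
  assumes T: "\<And>i. i \<ge> 1 \<Longrightarrow> T i \<omega> > 0" and "n \<ge> 1"
  shows "of_nat n \<le> renewal_count T t \<omega> \<longleftrightarrow> (\<Sum>i=1..n. T i \<omega>) \<le> t"
proof -
  let ?\<tau> = "\<lambda>n. \<Sum>i=1..n. T i \<omega>" and ?f = "\<lambda>k. indicator {s. s \<le> t} (\<Sum>i=1..Suc k. T i \<omega>) :: ennreal"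
  have mono: "?\<tau> m \<le> ?\<tau> k" if "m \<le> k" for m k
  proof (rule sum_mono2)
    show "0 \<le> T i \<omega>" if "i \<in> {1..k} - {1..m}" for i
      using T[of i] that by simp
  qed (use that in auto)
  show ?thesis
  proof
    assume "?\<tau> n \<le> t"
    then have "?f k = 1" if "k < n" for k
      using mono[of "Suc k" n] that by auto
    then have "of_nat n = (\<Sum>k<n. ?f k)" by simp
    also have "\<dots> \<le> renewal_count T t \<omega>"
      unfolding renewal_count_def by (intro sum_le_suminf) auto
    finally show "of_nat n \<le> renewal_count T t \<omega>" .
  next
    assume le: "of_nat n \<le> renewal_count T t \<omega>"
    show "?\<tau> n \<le> t"
    proof (rule ccontr)
      assume "\<not> ?\<tau> n \<le> t"
      \<comment> \<open>Index \<open>k\<close> stands for arrival \<open>k + 1\<close>, so a late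
        arrival \<open>n\<close> kills all terms from index \<open>n - 1\<close> on and leaves at
        most \<open>n - 1\<close> ones.\<close>
      then have "?f k = 0" if "k \<notin> {..<n - 1}" for k
      proof -
        have "n \<le> Suc k" using that by simp
        from mono[OF this] \<open>\<not> ?\<tau> n \<le> t\<close> show ?thesis by (simp add: indicator_def)
      qed
      then have "renewal_count T t \<omega> = (\<Sum>k<n - 1. ?f k)"
        unfolding renewal_count_def by (intro suminf_finite) auto
      also have "\<dots> \<le> (\<Sum>k<n - 1. 1)"
        by (intro sum_mono) (auto simp: indicator_def)
      also have "\<dots> < of_nat n"
        using \<open>n \<ge> 1\<close> by (simp add: ennreal_of_nat_eq_real_of_nat ennreal_less_iff)
      finally show False using le by simp
    qed
  qed
qed

lemma total_claims_mono: "m \<le> n \<Longrightarrow> total_claims U m \<omega> \<le> total_claims U n \<omega>"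
  unfolding total_claims_def by (intro suminf_le) (auto intro: order_trans)

text \<open>A series in \<open>ennreal\<close> is the supremum of its partial sums, and each of
  these is the sum of the first \<open>n\<close> claims for some \<open>n\<close> not above
  \<open>N\<close>. This holds for infinite \<open>N\<close> as well.\<close>

lemma less_total_claims_iff:
  assumes U: "\<And>k. k \<ge> 1 \<Longrightarrow> U k \<omega> \<ge> 0" and "x \<ge> 0"
  shows "ennreal x < total_claims U N \<omega> \<longleftrightarrow> (\<exists>n\<ge>1. of_nat n \<le> N \<and> x < (\<Sum>k=1..n. U k \<omega>))"
proof -
  let ?f = "\<lambda>k. if of_nat (Suc k) \<le> N then ennreal (U (Suc k) \<omega>) else 0"
  have full: "(\<Sum>k<m. ?f k) = ennreal (\<Sum>k=1..m. U k \<omega>)" if "of_nat m \<le> N" for m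
  proof -
    have "of_nat (Suc k) \<le> N" if "k < m" for k
      using \<open>of_nat m \<le> N\<close> that by (meson Suc_leI of_nat_mono order_trans)
    then have "(\<Sum>k<m. ?f k) = (\<Sum>k<m. ennreal (U (Suc k) \<omega>))"
      by (intro sum.cong) auto
    also have "\<dots> = (\<Sum>k=1..m. ennreal (U k \<omega>))"
      by (rule sum.reindex_bij_witness[of _ "\<lambda>k. k - 1" Suc]) auto
    also have "\<dots> = ennreal (\<Sum>k=1..m. U k \<omega>)"
      using U by (intro sum_ennreal) auto
    finally show ?thesis .
  qed
  have partial: "\<exists>n. of_nat n \<le> N \<and> (\<Sum>k<m. ?f k) = ennreal (\<Sum>k=1..n. U k \<omega>)" for m
  proof (induction m)
    case (Suc m)
    show ?case
    proof (cases "of_nat (Suc m) \<le> N")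
      case True
      then show ?thesis using full by blast
    next
      case False
      then show ?thesis using Suc by simp
    qed
  qed (auto intro: exI[of _ 0])
  have "ennreal x < total_claims U N \<omega> \<longleftrightarrow> (\<exists>m. ennreal x < (\<Sum>k<m. ?f k))"
    unfolding total_claims_def by (subst suminf_eq_SUP) (simp add: less_SUP_iff)
  also have "\<dots> \<longleftrightarrow> (\<exists>n. of_nat n \<le> N \<and> ennreal x < ennreal (\<Sum>k=1..n. U k \<omega>))"
    using full partial by metis
  also have "\<dots> \<longleftrightarrow> (\<exists>n. of_nat n \<le> N \<and> x < (\<Sum>k=1..n. U k \<omega>))"
    using \<open>x \<ge> 0\<close> by (simp add: ennreal_less_iff)
  \<comment> \<open>The empty sum for \<open>n = 0\<close> cannot exceed the nonnegative
    \<open>x\<close>.\<close>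
  also have "\<dots> \<longleftrightarrow> (\<exists>n\<ge>1. of_nat n \<le> N \<and> x < (\<Sum>k=1..n. U k \<omega>))"
  proof -
    have "n \<ge> 1" if "x < (\<Sum>k=1..n. U k \<omega>)" for n
      using that \<open>x \<ge> 0\<close> by (cases n) auto
    then show ?thesis by blast
  qed
  finally show ?thesis .
qed

text \<open>Nonnegativity of \<open>u + c * t\<close> keeps \<open>ennreal\<close> from truncating
  it; infinite total claims make both sides true.\<close>

lemma reserve_neg_iff:
  assumes "0 \<le> u + c * t"
  shows "reserve T U c u t \<omega> < 0 \<longleftrightarrow> ennreal (u + c * t) < total_claims U (renewal_count T t \<omega>) \<omega>"
proof -
  have "ereal a - enn2ereal C < 0 \<longleftrightarrow> ennreal a < C" if "0 \<le> a" for a C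
    using that by (cases C) (auto simp: ennreal_less_iff)
  then show ?thesis using assms by (simp add: reserve_def)
qed

text \<open>Ruin means that some \<open>n\<close> claims, all arrived by time \<open>t\<close>,
  exceed \<open>u + c * t\<close>. For fixed \<open>n\<close> this is easiest at the smallest
  admissible \<open>t\<close>, the arrival time of claim \<open>n\<close>, because premiums only
  accumulate afterwards.\<close>

lemma ruin_iff_walk_exceeds:
  assumes T: "\<And>i. i \<ge> 1 \<Longrightarrow> T i \<omega> > 0" and U: "\<And>k. k \<ge> 1 \<Longrightarrow> U k \<omega> > 0"
    and "0 \<le> u" "0 < c"
  shows "(\<exists>t\<ge>0. reserve T U c u t \<omega> < 0) \<longleftrightarrow> (\<exists>n\<ge>1. (\<Sum>i=1..n. U i \<omega> - c * T i \<omega>) > u)"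
proof -
  have "(reserve T U c u t \<omega> < 0) \<longleftrightarrow>
      (\<exists>n\<ge>1. (\<Sum>i=1..n. T i \<omega>) \<le> t \<and> u + c * t < (\<Sum>k=1..n. U k \<omega>))" if "t \<ge> 0" for t
    using that assms renewal_count_ge_iff[of T \<omega> _ t, OF T]
    by (subst reserve_neg_iff, simp, subst less_total_claims_iff) (auto intro: less_imp_le)
  then have "(\<exists>t\<ge>0. reserve T U c u t \<omega> < 0) \<longleftrightarrow>
      (\<exists>n\<ge>1. \<exists>t\<ge>0. (\<Sum>i=1..n. T i \<omega>) \<le> t \<and> u + c * t < (\<Sum>k=1..n. U k \<omega>))"
    by blast
  also have "\<dots> \<longleftrightarrow> (\<exists>n\<ge>1. u + c * (\<Sum>i=1..n. T i \<omega>) < (\<Sum>k=1..n. U k \<omega>))"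
  proof -
    have "(\<exists>t\<ge>0. \<tau> \<le> t \<and> u + c * t < r) \<longleftrightarrow> u + c * \<tau> < r" if "\<tau> \<ge> 0" for \<tau> r
      using that \<open>0 < c\<close> by (auto intro: le_less_trans[rotated])
    moreover have "(\<Sum>i=1..n. T i \<omega>) \<ge> 0" for n
      using T by (intro sum_nonneg) (auto intro: less_imp_le)
    ultimately show ?thesis by simp
  qed
  finally show ?thesis
    by (simp add: sum_subtractf sum_distrib_left algebra_simps)
qed

section \<open>Measurability of the ruin event\<close>

lemma measurable_renewal_count:
  assumes "\<And>i. i \<ge> 1 \<Longrightarrow> T i \<in> borel_measurable M"
  shows "renewal_count T t \<in> borel_measurable M"
proof -
  have [measurable]: "(\<lambda>\<omega>. \<Sum>i=1..Suc n. T i \<omega>) \<in> borel_measurable M" for n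
    using assms by (intro borel_measurable_sum) auto
  show ?thesis unfolding renewal_count_def[abs_def] by measurable
qed

lemma measurable_total_claims:
  assumes "\<And>k. k \<ge> 1 \<Longrightarrow> U k \<in> borel_measurable M" and [measurable]: "N \<in> borel_measurable M"
  shows "(\<lambda>\<omega>. total_claims U (N \<omega>) \<omega>) \<in> borel_measurable M"
proof -
  have [measurable]: "U (Suc k) \<in> borel_measurable M" for k
    using assms by simp
  show ?thesis unfolding total_claims_def by measurable
qed

text \<open>Since the total claims do not decrease in time, a ruin time can be moved slightly to the
  right, onto a rational.\<close>

lemma sets_ruin:
  assumes T: "\<And>i. i \<ge> 1 \<Longrightarrow> T i \<in> borel_measurable M" and U: "\<And>k. k \<ge> 1 \<Longrightarrow> U k \<in> borel_measurable M"
    and "0 \<le> u" "0 < c"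
  shows "{\<omega> \<in> space M. \<exists>t\<ge>0. reserve T U c u t \<omega> < 0} \<in> sets M"
proof -
  let ?C = "\<lambda>t \<omega>. total_claims U (renewal_count T t \<omega>) \<omega>"
  note [measurable] = measurable_total_claims[OF U measurable_renewal_count[OF T]]
  have neg_iff: "reserve T U c u t \<omega> < 0 \<longleftrightarrow> ennreal (u + c * t) < ?C t \<omega>" if "t \<ge> 0" for t \<omega>
    using that assms by (intro reserve_neg_iff) auto
  have "(\<exists>t\<ge>0. reserve T U c u t \<omega> < 0) \<longleftrightarrow> (\<exists>q\<in>{q\<in>\<rat>. q \<ge> 0}. ennreal (u + c * q) < ?C q \<omega>)" for \<omega>
  proof
    assume "\<exists>t\<ge>0. reserve T U c u t \<omega> < 0"
    then obtain t where t: "t \<ge> 0" "ennreal (u + c * t) < ?C t \<omega>"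
      using neg_iff by auto
    obtain y where y: "ennreal (u + c * t) < y" "y < ?C t \<omega>"
      using dense[OF t(2)] by blast
    then obtain r where r: "r \<ge> 0" "y = ennreal r"
      by (cases y) auto
    have "u + c * t < r"
      using y(1) r t assms by (simp add: ennreal_less_iff del: ennreal_plus)
    \<comment> \<open>\<open>(r - u) / c\<close> is the time at which capital plus premiums reach
      \<open>r\<close>; any rational between \<open>t\<close> and it still witnesses ruin.\<close>
    then have "t < (r - u) / c"
      using assms by (simp add: field_simps)
    then obtain q where q: "q \<in> \<rat>" "t < q" "q < (r - u) / c"
      using Rats_dense_in_real by blast
    then have "ennreal (u + c * q) \<le> y"
      using assms r by (auto simp: field_simps intro!: ennreal_leI)
    also have "y < ?C t \<omega>" by (rule y)
    also have "\<dots> \<le> ?C q \<omega>"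
      using q by (intro total_claims_mono renewal_count_mono) auto
    finally show "\<exists>q\<in>{q\<in>\<rat>. q \<ge> 0}. ennreal (u + c * q) < ?C q \<omega>"
      using q t by (intro bexI[of _ q]) auto
  qed (use neg_iff in auto)
  then have "{\<omega> \<in> space M. \<exists>t\<ge>0. reserve T U c u t \<omega> < 0}
      = (\<Union>q\<in>{q\<in>\<rat>. q \<ge> 0}. {\<omega> \<in> space M. ennreal (u + c * q) < ?C q \<omega>})"
    by auto
  also have "\<dots> \<in> sets M"
    by (intro sets.countable_UN' countable_subset[OF _ countable_rat]) auto
  finally show ?thesis .
qed

section \<open>Recovering arrival times from counts\<close>

text \<open>Only the renewal counts are assumed independent of the claims; the arrival times are
  recovered from the counts at rational times.\<close>

definition arrival_time :: "(real \<Rightarrow> 'a \<Rightarrow> ennreal) \<Rightarrow> nat \<Rightarrow> 'a \<Rightarrow> real" where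
  "arrival_time N n \<omega> =
     enn2real (INF q\<in>{q\<in>\<rat>. q \<ge> 0}. if of_nat n \<le> N q \<omega> then ennreal q else \<top>)"

text \<open>The count reaches \<open>n\<close> exactly from the \<open>n\<close>-th arrival on, and
  rationals approach that time from the right.\<close>

lemma arrival_time_renewal_count:
  assumes T: "\<And>i. i \<ge> 1 \<Longrightarrow> T i \<omega> > 0"
  shows "arrival_time (renewal_count T) n \<omega> = (\<Sum>i=1..n. T i \<omega>)"
proof -
  let ?\<tau> = "\<Sum>i=1..n. T i \<omega>" and ?Q = "{q\<in>\<rat>. q \<ge> (0 :: real)}"
  let ?f = "\<lambda>q. if of_nat n \<le> renewal_count T q \<omega> then ennreal q else \<top>"
  have \<tau>: "?\<tau> \<ge> 0"
    using T by (intro sum_nonneg) (auto intro: less_imp_le)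
  \<comment> \<open>For \<open>n = 0\<close> both sides are true, the empty sum being 0.\<close>
  have iff: "of_nat n \<le> renewal_count T q \<omega> \<longleftrightarrow> ?\<tau> \<le> q" if "q \<ge> 0" for q
    using renewal_count_ge_iff[of T \<omega> n q, OF T] that by (cases "n = 0") auto
  have "(INF q\<in>?Q. ?f q) = ennreal ?\<tau>"
  proof (rule antisym)
    show "ennreal ?\<tau> \<le> (INF q\<in>?Q. ?f q)"
      using iff by (intro INF_greatest) (auto intro: ennreal_leI)
    show "(INF q\<in>?Q. ?f q) \<le> ennreal ?\<tau>"
    proof (rule ennreal_le_epsilon)
      fix e :: real assume "0 < e"
      then obtain q where q: "q \<in> \<rat>" "?\<tau> < q" "q < ?\<tau> + e"
        using Rats_dense_in_real[of ?\<tau> "?\<tau> + e"] by auto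
      have "(INF q\<in>?Q. ?f q) \<le> ?f q"
        using q \<tau> by (intro INF_lower) auto
      also have "\<dots> = ennreal q"
        using q \<tau> iff[of q] by simp
      also have "\<dots> \<le> ennreal (?\<tau> + e)"
        using q by (intro ennreal_leI) auto
      finally show "(INF q\<in>?Q. ?f q) \<le> ennreal ?\<tau> + ennreal e"
        using \<tau> \<open>0 < e\<close> by simp
    qed
  qed
  then show ?thesis using \<tau> by (simp add: arrival_time_def)
qed

lemma measurable_arrival_time:
  assumes "\<And>t. t \<ge> 0 \<Longrightarrow> N t \<in> borel_measurable M"
  shows "arrival_time N n \<in> borel_measurable M"
proof -
  have "(\<lambda>\<omega>. INF q\<in>{q\<in>\<rat>. q \<ge> 0}. if of_nat n \<le> N q \<omega> then ennreal q else \<top>) \<in> borel_measurable M"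
  proof (rule borel_measurable_INF)
    show "countable {q\<in>\<rat>. q \<ge> (0 :: real)}"
      by (rule countable_subset[OF _ countable_rat]) auto
    fix q :: real assume "q \<in> {q\<in>\<rat>. q \<ge> 0}"
    then have [measurable]: "N q \<in> borel_measurable M" using assms by simp
    show "(\<lambda>\<omega>. if of_nat n \<le> N q \<omega> then ennreal q else \<top>) \<in> borel_measurable M"
      by measurable
  qed
  then show ?thesis unfolding arrival_time_def[abs_def] by measurable
qed

section \<open>Joint independence of claims and waiting times\<close>

lemma measurable_vimage_algebra_component:
  assumes "i \<in> I"
  shows "X i \<in> vimage_algebra S (\<lambda>\<omega>. \<lambda>i\<in>I. X i \<omega>) (\<Pi>\<^sub>M i\<in>I. borel) \<rightarrow>\<^sub>M borel"
proof -
  have "(\<lambda>f. f i) \<circ> (\<lambda>\<omega>. \<lambda>i\<in>I. X i \<omega>)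
      \<in> vimage_algebra S (\<lambda>\<omega>. \<lambda>i\<in>I. X i \<omega>) (\<Pi>\<^sub>M i\<in>I. borel) \<rightarrow>\<^sub>M borel"
    by (rule measurable_comp[OF measurable_vimage_algebra1 measurable_component_singleton])
       (use assms in \<open>auto simp: space_PiM\<close>)
  then show ?thesis using assms by (simp add: comp_def)
qed

text \<open>The family \<open>Y\<close> may consist of functions of the generating family
  \<open>X\<close>, such as waiting times computed from counts.\<close>

lemma Inter_vimage_in_generated_events:
  assumes Y: "\<And>j. j \<in> K \<Longrightarrow> Y j \<in> borel_measurable (vimage_algebra (space P) (\<lambda>\<omega>. \<lambda>i\<in>I. X i \<omega>) (\<Pi>\<^sub>M i\<in>I. borel))"
    and "finite K" "K \<noteq> {}" "\<And>j. j \<in> K \<Longrightarrow> A j \<in> sets borel"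
  shows "(\<Inter>j\<in>K. Y j -` A j \<inter> space P) \<in> generated_events P I X"
  unfolding generated_events_def
  using measurable_sets[OF Y] assms(2-) by (intro sets.finite_INT) auto

text \<open>A finite index set in the disjoint sum splits into its two halves: \<open>cross\<close>
  separates the halves, and independence within each family factors them further.\<close>

lemma (in prob_space) indep_vars_case_sum:
  assumes X: "indep_vars (\<lambda>_. borel) X I" and Y: "indep_vars (\<lambda>_. borel) Y J"
    and cross: "\<And>K L A B. \<lbrakk>finite K; K \<noteq> {}; K \<subseteq> I; finite L; L \<noteq> {}; L \<subseteq> J;
        \<And>i. i \<in> K \<Longrightarrow> A i \<in> sets borel; \<And>j. j \<in> L \<Longrightarrow> B j \<in> sets borel\<rbrakk> \<Longrightarrow>
      prob ((\<Inter>i\<in>K. X i -` A i \<inter> space M) \<inter> (\<Inter>j\<in>L. Y j -` B j \<inter> space M))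
        = prob (\<Inter>i\<in>K. X i -` A i \<inter> space M) * prob (\<Inter>j\<in>L. Y j -` B j \<inter> space M)"
  shows "indep_vars (\<lambda>_. borel) (case_sum X Y) (I <+> J)"
  unfolding indep_vars_def2
proof (intro conjI ballI indep_setsI)
  fix i assume i: "i \<in> I <+> J"
  then show rv: "random_variable borel (case_sum X Y i)"
    using X Y by (auto simp: indep_vars_def)
  show "{case_sum X Y i -` A \<inter> space M |A. A \<in> sets borel} \<subseteq> events"
    using measurable_sets[OF rv] by auto
next
  fix E H
  assume H: "H \<noteq> {}" "H \<subseteq> I <+> J" "finite H"
    and E: "\<forall>h\<in>H. E h \<in> {case_sum X Y h -` A \<inter> space M |A. A \<in> sets borel}"
  then obtain C where C: "\<And>h. h \<in> H \<Longrightarrow> C h \<in> sets borel"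
      "\<And>h. h \<in> H \<Longrightarrow> E h = case_sum X Y h -` C h \<inter> space M"
    by (simp add: Bex_def) metis
  let ?K = "Inl -` H" and ?L = "Inr -` H"
  have split: "H = Inl ` ?K \<union> Inr ` ?L"
    using H(2) by auto
  have fin: "finite ?K" "finite ?L"
    using H(3) by (auto intro: finite_vimageI)
  have sub: "?K \<subseteq> I" "?L \<subseteq> J"
    using H(2) by auto
  let ?A = "\<Inter>i\<in>?K. X i -` C (Inl i) \<inter> space M" and ?B = "\<Inter>j\<in>?L. Y j -` C (Inr j) \<inter> space M"
  have pX: "prob ?A = (\<Prod>i\<in>?K. prob (X i -` C (Inl i) \<inter> space M))" if "?K \<noteq> {}"
    by (rule indep_varsD[OF X that fin(1) sub(1)]) (auto intro: C)
  have pY: "prob ?B = (\<Prod>j\<in>?L. prob (Y j -` C (Inr j) \<inter> space M))" if "?L \<noteq> {}"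
    by (rule indep_varsD[OF Y that fin(2) sub(2)]) (auto intro: C)
  have INT: "(\<Inter>h\<in>H. E h) = ?A \<inter> ?B"
  proof -
    have "(\<Inter>h\<in>H. E h) = (\<Inter>h\<in>H. case_sum X Y h -` C h \<inter> space M)"
      using C by auto
    also have "\<dots> = (\<Inter>h\<in>Inl ` ?K \<union> Inr ` ?L. case_sum X Y h -` C h \<inter> space M)"
      by (rule INF_cong[OF split]) simp
    also have "\<dots> = ?A \<inter> ?B"
      by (simp only: INT_Un image_image sum.case)
    finally show ?thesis .
  qed
  have PROD: "(\<Prod>h\<in>H. prob (E h))
    = (\<Prod>i\<in>?K. prob (X i -` C (Inl i) \<inter> space M)) * (\<Prod>j\<in>?L. prob (Y j -` C (Inr j) \<inter> space M))"
  proof -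
    have "(\<Prod>h\<in>H. prob (E h)) = (\<Prod>h\<in>H. prob (case_sum X Y h -` C h \<inter> space M))"
      using C by (intro prod.cong) auto
    also have "\<dots> = (\<Prod>h\<in>Inl ` ?K \<union> Inr ` ?L. prob (case_sum X Y h -` C h \<inter> space M))"
      by (rule prod.cong[OF split]) simp
    also have "\<dots> = (\<Prod>h\<in>Inl ` ?K. prob (case_sum X Y h -` C h \<inter> space M))
        * (\<Prod>h\<in>Inr ` ?L. prob (case_sum X Y h -` C h \<inter> space M))"
      using fin by (intro prod.union_disjoint finite_imageI) auto
    also have "(\<Prod>h\<in>Inl ` ?K. prob (case_sum X Y h -` C h \<inter> space M))
        = (\<Prod>i\<in>?K. prob (X i -` C (Inl i) \<inter> space M))"
      by (subst prod.reindex) (simp_all add: comp_def)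
    also have "(\<Prod>h\<in>Inr ` ?L. prob (case_sum X Y h -` C h \<inter> space M))
        = (\<Prod>j\<in>?L. prob (Y j -` C (Inr j) \<inter> space M))"
      by (subst prod.reindex) (simp_all add: comp_def)
    finally show ?thesis .
  qed
  \<comment> \<open>An intersection over an empty half is the whole type rather than
    \<open>space M\<close>, so such a half is dropped instead of being passed to
    \<open>cross\<close>.\<close>
  consider "?K = {}" "?L \<noteq> {}" | "?L = {}" "?K \<noteq> {}" | "?K \<noteq> {}" "?L \<noteq> {}"
    using H(1) split by fastforce
  then show "prob (\<Inter>h\<in>H. E h) = (\<Prod>h\<in>H. prob (E h))"
  proof cases
    case 1
    then show ?thesis unfolding INT PROD using pY by simp
  next
    case 2
    then show ?thesis unfolding INT PROD using pX by simp
  next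
    case 3
    have "prob (?A \<inter> ?B) = prob ?A * prob ?B"
      by (rule cross[OF fin(1) 3(1) sub(1) fin(2) 3(2) sub(2)]) (auto intro: C)
    with 3 show ?thesis unfolding INT PROD using pX pY by simp
  qed
qed

text \<open>Each waiting time agrees almost surely with a function of the counts, so the assumed
  independence from the counts passes to events about the waiting times.\<close>

lemma (in prob_space) indep_vars_claims_and_waiting_times:
  fixes T U :: "nat \<Rightarrow> 'a \<Rightarrow> real"
  assumes T: "indep_vars (\<lambda>_. borel) T {1..}" and U: "indep_vars (\<lambda>_. borel) U {1..}"
    and T_pos: "\<And>i. i \<ge> 1 \<Longrightarrow> AE \<omega> in M. T i \<omega> > 0"
    and indep: "indep_set (generated_events M {1..} U) (generated_events M {0..} (renewal_count T))"
  shows "indep_vars (\<lambda>_. borel) (case_sum U T) ({1..} <+> {1..})"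
proof (rule indep_vars_case_sum[OF U T])
  fix K L :: "nat set" and A B
  assume K: "finite K" "K \<noteq> {}" "K \<subseteq> {1..}" and L: "finite L" "L \<noteq> {}" "L \<subseteq> {1..}"
    and A: "\<And>i. i \<in> K \<Longrightarrow> A i \<in> sets (borel :: real measure)"
    and B: "\<And>j. j \<in> L \<Longrightarrow> B j \<in> sets (borel :: real measure)"
  let ?N = "renewal_count T"
  \<comment> \<open>Waiting times are differences of successive recovered arrival times; for
    \<open>i = 1\<close> the subtracted arrival time is that of index 0, which is 0.\<close>
  define T' where "T' i \<omega> = arrival_time ?N i \<omega> - arrival_time ?N (i - 1) \<omega>" for i \<omega>
  let ?a = "\<Inter>i\<in>K. U i -` A i \<inter> space M" and ?b = "\<Inter>j\<in>L. T j -` B j \<inter> space M"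
    and ?b' = "\<Inter>j\<in>L. T' j -` B j \<inter> space M"
  have a: "?a \<in> generated_events M {1..} U"
    using K A by (intro Inter_vimage_in_generated_events measurable_vimage_algebra_component) auto
  have "T' j \<in> borel_measurable (vimage_algebra (space M) (\<lambda>\<omega>. \<lambda>i\<in>{0..}. ?N i \<omega>) (\<Pi>\<^sub>M i\<in>{0..}. borel))" for j
    unfolding T'_def by (intro borel_measurable_diff measurable_arrival_time measurable_vimage_algebra_component) auto
  then have b': "?b' \<in> generated_events M {0..} ?N"
    using L B by (intro Inter_vimage_in_generated_events) auto
  have events: "?a \<in> events" "?b' \<in> events"
    using indep a b' unfolding indep_sets2_eq by blast+
  have T_rv: "random_variable borel (T j)" if "j \<in> L" for j
    using T L that by (auto simp: indep_vars_def)
  have b: "?b \<in> events"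
    using L measurable_sets[OF T_rv B] by (intro sets.finite_INT) auto
  have "AE \<omega> in M. \<forall>i\<in>{1..}. T i \<omega> > 0"
    using T_pos by (subst AE_ball_countable) auto
  then have eq: "AE \<omega> in M. \<omega> \<in> ?b \<longleftrightarrow> \<omega> \<in> ?b'"
  proof eventually_elim
    case (elim \<omega>)
    have "T' j \<omega> = T j \<omega>" if "j \<in> L" for j
      using that L elim by (cases j) (auto simp: T'_def arrival_time_renewal_count)
    then show ?case by auto
  qed
  \<comment> \<open>The events \<open>?b\<close> and \<open>?b'\<close> differ by a null set, and
    only \<open>?b'\<close> is known to be generated by the counts.\<close>
  have "prob (?a \<inter> ?b) = prob (?a \<inter> ?b')"
    using eq events b by (intro finite_measure_eq_AE) auto
  also have "\<dots> = prob ?a * prob ?b'"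
    by (rule indep_setD[OF indep a b'])
  also have "prob ?b' = prob ?b"
    using eq events b by (intro finite_measure_eq_AE) auto
  finally show "prob (?a \<inter> ?b) = prob ?a * prob ?b" .
qed

section \<open>Moment generating functions and increments\<close>

text \<open>The expectation of a positive function on a probability space is nonzero, so excluding
  infinity leaves the real branch of \<open>ennreal_log\<close>.\<close>

lemma (in prob_space)
  assumes [measurable]: "X \<in> borel_measurable M" and "log_mgf M X \<theta> \<noteq> \<infinity>"
  shows integrable_exp_of_log_mgf: "integrable M (\<lambda>\<omega>. exp (\<theta> * X \<omega>))"
    and log_mgf_eq_ln: "log_mgf M X \<theta> = ereal (ln (expectation (\<lambda>\<omega>. exp (\<theta> * X \<omega>))))"
    and expectation_exp_pos: "expectation (\<lambda>\<omega>. exp (\<theta> * X \<omega>)) > 0"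
proof -
  let ?I = "\<integral>\<^sup>+ \<omega>. ennreal (exp (\<theta> * X \<omega>)) \<partial>M"
  have "?I \<noteq> 0"
    by (subst nn_integral_0_iff_AE) auto
  moreover have "?I \<noteq> \<infinity>"
    using assms(2) by (auto simp: log_mgf_def ennreal_log_def)
  moreover from this show int: "integrable M (\<lambda>\<omega>. exp (\<theta> * X \<omega>))"
    by (intro integrableI_bounded) (auto simp: top.not_eq_extremum)
  have I: "?I = ennreal (expectation (\<lambda>\<omega>. exp (\<theta> * X \<omega>)))"
    by (rule nn_integral_eq_integral[OF int]) auto
  ultimately show "expectation (\<lambda>\<omega>. exp (\<theta> * X \<omega>)) > 0"
    by (simp add: ennreal_eq_0_iff not_le)
  then show "log_mgf M X \<theta> = ereal (ln (expectation (\<lambda>\<omega>. exp (\<theta> * X \<omega>))))"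
    by (simp add: log_mgf_def ennreal_log_def I)
qed

text \<open>Functions of disjoint blocks of an independent family are independent: the blocks are
  the pairs \<open>Inl n\<close>, \<open>Inr n\<close> for the increments and singletons for the
  second claim.\<close>

lemma (in prob_space) indep_vars_increments:
  fixes T U :: "nat \<Rightarrow> 'a \<Rightarrow> real"
  assumes "indep_vars (\<lambda>_. borel) (case_sum U T) ({1..} <+> {1..})"
  shows "indep_vars (\<lambda>_. borel) (\<lambda>n \<omega>. U n \<omega> - c * T n \<omega>) {1..}"
    and "n \<ge> 1 \<Longrightarrow> indep_var borel (U n) borel (T n)"
proof -
  let ?Z = "case_sum U T" and ?K = "\<lambda>n. {Inl n, Inr n} :: (nat + nat) set"
  have "indep_vars (\<lambda>n. PiM (?K n) (\<lambda>_. borel)) (\<lambda>n \<omega>. restrict (\<lambda>i. ?Z i \<omega>) (?K n)) {1..}"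
    by (rule indep_vars_restrict[OF assms]) (auto simp: disjoint_family_on_def)
  then have "indep_vars (\<lambda>_. borel)
      (\<lambda>n \<omega>. (\<lambda>f. f (Inl n) - c * f (Inr n)) (restrict (\<lambda>i. ?Z i \<omega>) (?K n))) {1..}"
    by (rule indep_vars_compose2) measurable
  then show "indep_vars (\<lambda>_. borel) (\<lambda>n \<omega>. U n \<omega> - c * T n \<omega>) {1..}"
    by simp
  show "indep_var borel (U n) borel (T n)" if "n \<ge> 1"
  proof -
    have "indep_var (PiM {Inl n} (\<lambda>_. borel)) (\<lambda>\<omega>. restrict (\<lambda>i. ?Z i \<omega>) {Inl n})
        (PiM {Inr n} (\<lambda>_. borel)) (\<lambda>\<omega>. restrict (\<lambda>i. ?Z i \<omega>) {Inr n})"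
      by (rule indep_var_restrict[OF assms]) (use that in auto)
    from indep_var_compose[OF this measurable_component_singleton[of "Inl n"]
        measurable_component_singleton[of "Inr n"]]
    show ?thesis by (simp add: comp_def)
  qed
qed

text \<open>By independence the joint law is the product of the marginals, so equal marginals give
  equally distributed increments.\<close>

lemma (in prob_space) distr_increment:
  fixes X Y :: "'a \<Rightarrow> real"
  assumes "indep_var borel X borel Y"
  shows "distr M borel (\<lambda>\<omega>. X \<omega> - c * Y \<omega>)
    = distr (distr M borel X \<Otimes>\<^sub>M distr M borel Y) borel (\<lambda>(x, y). x - c * y)"
proof -
  note [measurable] = indep_var_rv1[OF assms] indep_var_rv2[OF assms]
  have "distr M borel X \<Otimes>\<^sub>M distr M borel Y = distr M (borel \<Otimes>\<^sub>M borel) (\<lambda>\<omega>. (X \<omega>, Y \<omega>))"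
    using assms by (simp add: indep_var_distribution_eq)
  then show ?thesis
    by (simp add: distr_distr comp_def)
qed

text \<open>A law with a density has no atoms, so for each fixed \<open>x\<close> the event
  \<open>Y = x / c\<close> is null; Fubini's theorem for the product law then makes the increment
  nonzero almost surely.\<close>

lemma (in prob_space) increment_not_AE_zero:
  fixes X Y :: "'a \<Rightarrow> real"
  assumes indep: "indep_var borel X borel Y" and Y: "distributed M lborel Y f" and "c \<noteq> 0"
  shows "\<not> (AE \<omega> in M. X \<omega> - c * Y \<omega> = 0)"
proof
  assume zero: "AE \<omega> in M. X \<omega> - c * Y \<omega> = 0"
  note [measurable] = indep_var_rv1[OF indep] indep_var_rv2[OF indep]
  interpret X: prob_space "distr M borel X" by (rule prob_space_distr) measurable
  interpret Y: prob_space "distr M borel Y" by (rule prob_space_distr) measurable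
  interpret XY: pair_sigma_finite "distr M borel X" "distr M borel Y" ..
  have distr_Y: "distr M borel Y = density lborel f"
    using distributed_distr_eq_density[OF Y] by (simp cong: distr_cong)
  have [measurable]: "f \<in> borel_measurable borel"
    using distributed_borel_measurable[OF Y] by simp
  have "AE y in distr M borel Y. x - c * y \<noteq> 0" for x
  proof -
    have "AE y in lborel. y \<noteq> x / c" by (rule AE_lborel_singleton)
    then have "AE y in lborel. f y > 0 \<longrightarrow> x - c * y \<noteq> 0"
      by eventually_elim (use \<open>c \<noteq> 0\<close> in \<open>auto simp: field_simps\<close>)
    then show ?thesis unfolding distr_Y by (subst AE_density) auto
  qed
  moreover have "{z \<in> space (distr M borel X \<Otimes>\<^sub>M distr M borel Y). fst z - c * snd z \<noteq> 0}
      \<in> sets (distr M borel X \<Otimes>\<^sub>M distr M borel Y)"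
    by (rule borel_measurable_neq) measurable
  ultimately have "AE z in distr M borel X \<Otimes>\<^sub>M distr M borel Y. fst z - c * snd z \<noteq> 0"
    by (subst XY.AE_pair_iff[symmetric]) simp_all
  also have "distr M borel X \<Otimes>\<^sub>M distr M borel Y = distr M (borel \<Otimes>\<^sub>M borel) (\<lambda>\<omega>. (X \<omega>, Y \<omega>))"
    using indep by (simp add: indep_var_distribution_eq)
  finally have "AE \<omega> in M. X \<omega> - c * Y \<omega> \<noteq> 0"
    using AE_distrD[of "\<lambda>\<omega>. (X \<omega>, Y \<omega>)" M "borel \<Otimes>\<^sub>M borel"] by fastforce
  with zero have "AE \<omega> in M. False" by eventually_elim simp
  then show False by simp
qed

section \<open>From the random walk to the ruin probability\<close>

theorem proposition3p3:
  fixes P :: "'a measure"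
    and T U :: "nat \<Rightarrow> 'a \<Rightarrow> real"
    and \<nu> h lam c w :: real
  assumes "prob_space P"
    and "0 < \<nu>" "\<nu> < 1" "h > 0" "lam > 0" "c > 0"
    and "prob_space.indep_vars P (\<lambda>_. borel) T {1..}"
    and "\<And>n. n \<ge> 1 \<Longrightarrow> distributed P lborel (T n) (\<lambda>t. ennreal (waiting_density \<nu> h lam t))"
    and "prob_space.indep_vars P (\<lambda>_. borel) U {1..}"
    and "\<And>k. k \<ge> 1 \<Longrightarrow> distr P borel (U k) = distr P borel (U 1)"
    and "\<And>k. k \<ge> 1 \<Longrightarrow> AE \<omega> in P. U k \<omega> > 0"
    and "prob_space.indep_set P (generated_events P {1..} U)
           (generated_events P {0..} (renewal_count T))"
    and "w \<in> {0<..} \<inter> interior {\<theta>. kappa P T U c \<theta> < \<infinity>}"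
    and "kappa P T U c w = 0"
  shows "((\<lambda>u. 1 / u * ln (ruin_prob P T U c u)) \<longlongrightarrow> - w) at_top"
proof -
  interpret prob_space P by (rule assms(1))
  define X where "X n \<omega> = U n \<omega> - c * T n \<omega>" for n \<omega>
  have T_rv [measurable]: "T i \<in> borel_measurable P" if "i \<ge> 1" for i
    using assms(7) that by (auto simp: indep_vars_def)
  have U_rv [measurable]: "U k \<in> borel_measurable P" if "k \<ge> 1" for k
    using assms(9) that by (auto simp: indep_vars_def)
  have T_distr: "distr P borel (T i) = density lborel (\<lambda>t. ennreal (waiting_density \<nu> h lam t))"
    if "i \<ge> 1" for i
  proof -
    have "distr P borel (T i) = distr P lborel (T i)"
      by (rule distr_cong) simp_all
    also note distributed_distr_eq_density[OF assms(8)[OF that]]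
    finally show ?thesis .
  qed
  have T_pos: "AE \<omega> in P. T i \<omega> > 0" if "i \<ge> 1" for i
  proof -
    have "waiting_density \<nu> h lam t = 0" if "\<not> t > 0" for t
      using that by (simp add: waiting_density_def)
    then have "AE t in lborel. 0 < ennreal (waiting_density \<nu> h lam t) \<longrightarrow> 0 < t"
      by (intro AE_I2) (metis ennreal_0 less_irrefl)
    then have "AE t in density lborel (\<lambda>t. ennreal (waiting_density \<nu> h lam t)). 0 < t"
      using AE_density[OF distributed_borel_measurable[OF assms(8)[OF that]]] by blast
    then show ?thesis
      unfolding T_distr[OF that, symmetric] by (rule AE_distrD[OF T_rv[OF that]])
  qed
  note UT = indep_vars_claims_and_waiting_times[OF assms(7,9) T_pos assms(12)]
  have indep_UT: "indep_var borel (U k) borel (T k)" if "k \<ge> 1" for k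
    using indep_vars_increments(2)[OF UT that] by simp

  have int_U: "integrable P (\<lambda>\<omega>. exp (\<theta> * U 1 \<omega>))"
    and int_T: "integrable P (\<lambda>\<omega>. exp (- c * \<theta> * T 1 \<omega>))"
    and mgf_finite: "log_mgf P (U 1) \<theta> \<noteq> \<infinity>" "log_mgf P (T 1) (- c * \<theta>) \<noteq> \<infinity>"
    if "kappa P T U c \<theta> < \<infinity>" for \<theta>
  proof -
    \<comment> \<open>A sum in \<open>ereal\<close> is infinite as soon as one summand is, so a
      value below infinity bounds both.\<close>
    show *: "log_mgf P (U 1) \<theta> \<noteq> \<infinity>" "log_mgf P (T 1) (- c * \<theta>) \<noteq> \<infinity>"
      using that by (auto simp: kappa_def)
    show "integrable P (\<lambda>\<omega>. exp (\<theta> * U 1 \<omega>))" "integrable P (\<lambda>\<omega>. exp (- c * \<theta> * T 1 \<omega>))"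
      by (rule integrable_exp_of_log_mgf[OF U_rv[OF order.refl] *(1)]
          integrable_exp_of_log_mgf[OF T_rv[OF order.refl] *(2)])+
  qed
  have exp_X: "integrable P (\<lambda>\<omega>. exp (\<theta> * X 1 \<omega>))"
      "expectation (\<lambda>\<omega>. exp (\<theta> * X 1 \<omega>))
        = expectation (\<lambda>\<omega>. exp (\<theta> * U 1 \<omega>)) * expectation (\<lambda>\<omega>. exp (- c * \<theta> * T 1 \<omega>))"
    if "kappa P T U c \<theta> < \<infinity>" for \<theta>
  proof -
    have eq: "exp (\<theta> * X 1 \<omega>) = exp (\<theta> * U 1 \<omega>) * exp (- c * \<theta> * T 1 \<omega>)" for \<omega>
      by (simp add: X_def algebra_simps flip: exp_add)
    have ind: "indep_var borel (\<lambda>\<omega>. exp (\<theta> * U 1 \<omega>)) borel (\<lambda>\<omega>. exp (- c * \<theta> * T 1 \<omega>))"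
      using indep_var_compose[OF indep_UT[OF order.refl], of "\<lambda>x. exp (\<theta> * x)" borel "\<lambda>x. exp (- c * \<theta> * x)" borel]
      by (simp add: comp_def)
    show "integrable P (\<lambda>\<omega>. exp (\<theta> * X 1 \<omega>))"
      unfolding eq by (rule indep_var_integrable[OF ind int_U[OF that] int_T[OF that]])
    show "expectation (\<lambda>\<omega>. exp (\<theta> * X 1 \<omega>))
        = expectation (\<lambda>\<omega>. exp (\<theta> * U 1 \<omega>)) * expectation (\<lambda>\<omega>. exp (- c * \<theta> * T 1 \<omega>))"
      unfolding eq by (rule indep_var_lebesgue_integral[OF ind int_U[OF that] int_T[OF that]])
  qed

  have kw: "kappa P T U c w < \<infinity>"
    using assms(14) by simp
  have mgf_w: "expectation (\<lambda>\<omega>. exp (w * X 1 \<omega>)) = 1"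
  proof -
    let ?a = "expectation (\<lambda>\<omega>. exp (w * U 1 \<omega>))" and ?b = "expectation (\<lambda>\<omega>. exp (- c * w * T 1 \<omega>))"
    have pos: "?a > 0" "?b > 0"
      using expectation_exp_pos[OF U_rv[OF order.refl] mgf_finite(1)[OF kw]] expectation_exp_pos[OF T_rv[OF order.refl] mgf_finite(2)[OF kw]]
      by simp_all
    have "ereal (ln ?a) + ereal (ln ?b) = 0"
      using assms(14) log_mgf_eq_ln[OF U_rv[OF order.refl] mgf_finite(1)[OF kw]] log_mgf_eq_ln[OF T_rv[OF order.refl] mgf_finite(2)[OF kw]]
      by (simp add: kappa_def)
    then have "ln (?a * ?b) = 0"
      using pos by (simp add: ln_mult)
    then show ?thesis
      using pos exp_X(2)[OF kw] by (simp add: ln_eq_zero_iff)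
  qed
  obtain e where e: "e > 0" "ball w e \<subseteq> {\<theta>. kappa P T U c \<theta> < \<infinity>}"
    using assms(13) by (auto simp: mem_interior)
  \<comment> \<open>Half the radius stays inside the open ball and serves as the room
    \<open>d\<close> of the walk.\<close>
  then have "kappa P T U c (w + e / 2) < \<infinity>"
    by (auto simp: dist_real_def subset_iff)
  note int_wd = exp_X(1)[OF this]

  interpret walk: tilted_walk P X w "e / 2"
  proof
    show "indep_vars (\<lambda>_. borel) X {1..}"
      using indep_vars_increments(1)[OF UT, of c] by (simp add: X_def[abs_def])
    show "distr P borel (X k) = distr P borel (X 1)" if "k \<ge> 1" for k
      unfolding X_def[abs_def] distr_increment[OF indep_UT[OF that]] distr_increment[OF indep_UT[OF order.refl]]
      unfolding assms(10)[OF that] T_distr[OF that] T_distr[OF order.refl] ..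
    show "\<not> (AE \<omega> in P. X 1 \<omega> = 0)"
      unfolding X_def using assms(6)
      by (intro increment_not_AE_zero[OF indep_UT[OF order.refl] assms(8)[OF order.refl]]) simp
    show "0 < w" "0 < e / 2"
      using assms(13) e(1) by simp_all
  qed (fact int_wd mgf_w)+
  have "ruin_prob P T U c u = prob {\<omega> \<in> space P. \<exists>n\<ge>1. walk.S n \<omega> > u}" if "u > 0" for u
    unfolding ruin_prob_def
  \<comment> \<open>The two events agree wherever all waiting times and claims are positive, which
    holds almost surely.\<close>
  proof (rule finite_measure_eq_AE)
    have "AE \<omega> in P. \<forall>i\<in>{1..}. T i \<omega> > 0" "AE \<omega> in P. \<forall>i\<in>{1..}. U i \<omega> > 0"
      using T_pos assms(11) by (auto simp: AE_ball_countable)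
    then show "AE \<omega> in P. \<omega> \<in> {\<omega> \<in> space P. \<exists>t\<ge>0. reserve T U c u t \<omega> < 0}
        \<longleftrightarrow> \<omega> \<in> {\<omega> \<in> space P. \<exists>n\<ge>1. walk.S n \<omega> > u}"
    proof eventually_elim
      case (elim \<omega>)
      show ?case
        using ruin_iff_walk_exceeds[of T \<omega> U u c] elim that assms(6)
        by (simp add: walk.S_def X_def)
    qed
    show "{\<omega> \<in> space P. \<exists>t\<ge>0. reserve T U c u t \<omega> < 0} \<in> events"
      using that assms(6) by (intro sets_ruin T_rv U_rv) auto
  qed measurable
  then have "eventually (\<lambda>u. 1 / u * ln (prob {\<omega> \<in> space P. \<exists>n\<ge>1. walk.S n \<omega> > u})
      = 1 / u * ln (ruin_prob P T U c u)) at_top"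
    by (intro eventually_mono[OF eventually_gt_at_top[of 0]]) simp
  then show ?thesis
    by (rule Lim_transform_eventually[OF walk.log_prob_exceed_limit])
qed

end
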